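(* In the linear-model setting described in the context, assume there is a set $\mathbf{B}=\{j:\beta_j^2>b\}$, where $b$ is a positive constant, such that $|\mathbf{B}|=p_0$ where $p_0$ is a fixed constant. Also assume that $$\lim_{n\to\infty}n\left[P\left(\{\mathbf{B}_\gamma\ne\mathbf{B}\}\right)\right]^{1/2}=0,$$ and that $E(T_\gamma^4)$ and $E(T_{\mathbf{B}}^4)$ are bounded. Then $$\sqrt n\,(T_\gamma-T_{\mathbf{B}})\overset{p}{\rightarrow}0 .$$
   Context: Setting. $(X_1,Y_1),\dots,(X_n,Y_n)$ are i.i.d. with $X_i=(X_{i1},\dots,X_{ip})^T\in\mathbb{R}^p$, $Y_i=\beta^TX_i+\epsilon_i$, $E(\epsilon_i|X_i)=0$, $E(\epsilon_i^2|X_i)=\sigma^2$, $E(X_i)=0$, $\mathrm{Cov}(X_i)=\mathbf{I}$; the distribution of $X$ is known. Limits are as $n\to\infty$ with $p=p_n$. $\tau^2=\|\beta\|^2$, $W_{ij}=X_{ij}Y_i$, $W_i=(W_{i1},\dots,W_{ip})^T$, and $\hat\tau^2=\binom n2^{-1}\sum_{i_1<i_2}W_{i_1}^TW_{i_2}$. For $j,j'\in\{1,\dots,p\}$ let $$\hat\psi_{jj'}=\frac{1}{n(n-1)(n-2)}\sum_{i_1\ne i_2\ne i_3}W_{i_1j}W_{i_2j'}\left[X_{i_3j}X_{i_3j'}-E(X_{i_3j}X_{i_3j'})\right],$$ the sum being over pairwise distinct indices. A (covariate) selection algorithm $\gamma$ is a rule that for every dataset $(\mathbf{X}_{n\times p},\mathbf{Y}_{n\times1})$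 chooses a subset of indices $\mathbf{B}_\gamma\subseteq\{1,\dots,p\}$. Define $$T_\gamma=\hat\tau^2-2\sum_{j,j'\in\mathbf{B}_\gamma}\hat\psi_{jj'},\qquad T_{\mathbf{B}}=\hat\tau^2-2\sum_{j,j'\in\mathbf{B}}\hat\psi_{jj'} .$$ *)

theory Defs
  imports "HOL-Probability.Probability"
begin

text \<open>
  Observations are indexed by \<open>{1..n}\<close> and coordinates by \<open>{1..p}\<close>.  Since \<open>p\<close> varies with \<open>n\<close>,
  vectors in \<open>\<real>\<^sup>p\<close> are elements of the product space \<open>PiM {1..p} (\<lambda>_. borel)\<close>; as elements of such a
  product they have to be extensional, whence the restricted abstractions below.
\<close>

definition covariate_vector :: "nat \<Rightarrow> (nat \<Rightarrow> nat \<Rightarrow> 'a \<Rightarrow> real) \<Rightarrow> nat \<Rightarrow> 'a \<Rightarrow> (nat \<Rightarrow> real)" where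
  "covariate_vector p X i \<omega> = (\<lambda>j\<in>{1..p}. X i j \<omega>)"

abbreviation vec_space :: "nat \<Rightarrow> (nat \<Rightarrow> real) measure" where
  "vec_space p \<equiv> PiM {1..p} (\<lambda>_. borel)"

text \<open>
  The integrability assumptions are what it takes for the stated moments and conditional moments to
  exist; Isabelle's integral and conditional expectation have junk values otherwise.  Conditioning
  on \<open>X\<^sub>i\<close> is conditioning on the \<open>\<sigma>\<close>-algebra it generates, i.e. on
  \<open>vimage_algebra (space M) X\<^sub>i (vec_space p)\<close>.
\<close>

locale linear_model = prob_space M for M :: "'a measure" +
  fixes n p :: nat
    and X :: "nat \<Rightarrow> nat \<Rightarrow> 'a \<Rightarrow> real"
    and Y :: "nat \<Rightarrow> 'a \<Rightarrow> real"
    and \<epsilon> :: "nat \<Rightarrow> 'a \<Rightarrow> real"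
    and \<beta> :: "nat \<Rightarrow> real"
    and \<sigma> :: real
  assumes independent:
      "indep_vars (\<lambda>_. vec_space p \<Otimes>\<^sub>M borel) (\<lambda>i \<omega>. (covariate_vector p X i \<omega>, Y i \<omega>)) {1..n}"
    and identically_distributed:
      "\<And>i i'. i \<in> {1..n} \<Longrightarrow> i' \<in> {1..n} \<Longrightarrow>
         distr M (vec_space p \<Otimes>\<^sub>M borel) (\<lambda>\<omega>. (covariate_vector p X i \<omega>, Y i \<omega>)) =
         distr M (vec_space p \<Otimes>\<^sub>M borel) (\<lambda>\<omega>. (covariate_vector p X i' \<omega>, Y i' \<omega>))"
    and regression:
      "\<And>i \<omega>. i \<in> {1..n} \<Longrightarrow> \<omega> \<in> space M \<Longrightarrow> Y i \<omega> = (\<Sum>j\<in>{1..p}. \<beta> j * X i j \<omega>) + \<epsilon> i \<omega>"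
    and noise_integrable: "\<And>i. i \<in> {1..n} \<Longrightarrow> integrable M (\<epsilon> i)"
    and noise_sq_integrable: "\<And>i. i \<in> {1..n} \<Longrightarrow> integrable M (\<lambda>\<omega>. (\<epsilon> i \<omega>)\<^sup>2)"
    and noise_cond_mean:
      "\<And>i. i \<in> {1..n} \<Longrightarrow>
         AE \<omega> in M. real_cond_exp M
           (vimage_algebra (space M) (covariate_vector p X i) (vec_space p)) (\<epsilon> i) \<omega> = 0"
    and noise_cond_variance:
      "\<And>i. i \<in> {1..n} \<Longrightarrow>
         AE \<omega> in M. real_cond_exp M
           (vimage_algebra (space M) (covariate_vector p X i) (vec_space p))
           (\<lambda>\<omega>'. (\<epsilon> i \<omega>')\<^sup>2) \<omega> = \<sigma>\<^sup>2"
    and covariate_integrable: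
      "\<And>i j. i \<in> {1..n} \<Longrightarrow> j \<in> {1..p} \<Longrightarrow> integrable M (X i j)"
    and covariate_sq_integrable:
      "\<And>i j. i \<in> {1..n} \<Longrightarrow> j \<in> {1..p} \<Longrightarrow> integrable M (\<lambda>\<omega>. (X i j \<omega>)\<^sup>2)"
    and covariate_mean:
      "\<And>i j. i \<in> {1..n} \<Longrightarrow> j \<in> {1..p} \<Longrightarrow> expectation (X i j) = 0"
    and covariate_covariance:
      "\<And>i j j'. i \<in> {1..n} \<Longrightarrow> j \<in> {1..p} \<Longrightarrow> j' \<in> {1..p} \<Longrightarrow>
         expectation (\<lambda>\<omega>. (X i j \<omega> - expectation (X i j)) * (X i j' \<omega> - expectation (X i j'))) =
         (if j = j' then 1 else 0)"

definition W :: "(nat \<Rightarrow> nat \<Rightarrow> 'a \<Rightarrow> real) \<Rightarrow> (nat \<Rightarrow> 'a \<Rightarrow> real) \<Rightarrow> nat \<Rightarrow> nat \<Rightarrow> 'a \<Rightarrow> real" where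
  "W X Y i j \<omega> = X i j \<omega> * Y i \<omega>"

definition tau_sq_hat ::
  "nat \<Rightarrow> nat \<Rightarrow> (nat \<Rightarrow> nat \<Rightarrow> 'a \<Rightarrow> real) \<Rightarrow> (nat \<Rightarrow> 'a \<Rightarrow> real) \<Rightarrow> 'a \<Rightarrow> real" where
  "tau_sq_hat n p X Y \<omega> =
     (\<Sum>(i1, i2) \<in> {(i1, i2). i1 \<in> {1..n} \<and> i2 \<in> {1..n} \<and> i1 < i2}.
        \<Sum>j\<in>{1..p}. W X Y i1 j \<omega> * W X Y i2 j \<omega>) / real (n choose 2)"

text \<open>
  The law of the covariates is known, so the exact second moments of \<open>X\<close> under \<open>M\<close> may enter the
  statistic.
\<close>

definition psi_hat ::
  "'a measure \<Rightarrow> nat \<Rightarrow> (nat \<Rightarrow> nat \<Rightarrow> 'a \<Rightarrow> real) \<Rightarrow> (nat \<Rightarrow> 'a \<Rightarrow> real) \<Rightarrow> nat \<Rightarrow> nat \<Rightarrow> 'a \<Rightarrow> real" where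
  "psi_hat M n X Y j j' \<omega> =
     (\<Sum>(i1, i2, i3) \<in> {(i1, i2, i3). i1 \<in> {1..n} \<and> i2 \<in> {1..n} \<and> i3 \<in> {1..n} \<and>
                                     i1 \<noteq> i2 \<and> i2 \<noteq> i3 \<and> i1 \<noteq> i3}.
        W X Y i1 j \<omega> * W X Y i2 j' \<omega> *
        (X i3 j \<omega> * X i3 j' \<omega> - (\<integral>\<omega>'. X i3 j \<omega>' * X i3 j' \<omega>' \<partial>M)))
     / (real n * (real n - 1) * (real n - 2))"

definition T_set ::
  "'a measure \<Rightarrow> nat \<Rightarrow> nat \<Rightarrow> (nat \<Rightarrow> nat \<Rightarrow> 'a \<Rightarrow> real) \<Rightarrow> (nat \<Rightarrow> 'a \<Rightarrow> real) \<Rightarrow>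
   nat set \<Rightarrow> 'a \<Rightarrow> real" where
  "T_set M n p X Y B \<omega> =
     tau_sq_hat n p X Y \<omega> - 2 * (\<Sum>j\<in>B. \<Sum>j'\<in>B. psi_hat M n X Y j j' \<omega>)"

text \<open>
  A dataset is a pair of an \<open>n \<times> p\<close> matrix (a family of rows) and an \<open>n\<close>-vector.  A selection
  algorithm is a measurable map from datasets to subsets of \<open>{1..p}\<close>; without measurability the
  probability of selecting a given set would make no sense.
\<close>

type_synonym dataset = "(nat \<Rightarrow> nat \<Rightarrow> real) \<times> (nat \<Rightarrow> real)"

definition selection_algorithm :: "nat \<Rightarrow> nat \<Rightarrow> (dataset \<Rightarrow> nat set) \<Rightarrow> bool" where
  "selection_algorithm n p \<gamma> \<longleftrightarrow>
     \<gamma> \<in> measurable (PiM {1..n} (\<lambda>_. vec_space p) \<Otimes>\<^sub>M vec_space n) (count_space (Pow {1..p}))"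

definition sample ::
  "nat \<Rightarrow> nat \<Rightarrow> (nat \<Rightarrow> nat \<Rightarrow> 'a \<Rightarrow> real) \<Rightarrow> (nat \<Rightarrow> 'a \<Rightarrow> real) \<Rightarrow> 'a \<Rightarrow> dataset" where
  "sample n p X Y \<omega> = ((\<lambda>i\<in>{1..n}. covariate_vector p X i \<omega>), (\<lambda>i\<in>{1..n}. Y i \<omega>))"

definition selected_set ::
  "nat \<Rightarrow> nat \<Rightarrow> (nat \<Rightarrow> nat \<Rightarrow> 'a \<Rightarrow> real) \<Rightarrow> (nat \<Rightarrow> 'a \<Rightarrow> real) \<Rightarrow>
   (dataset \<Rightarrow> nat set) \<Rightarrow> 'a \<Rightarrow> nat set" where
  "selected_set n p X Y \<gamma> \<omega> = \<gamma> (sample n p X Y \<omega>)"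

definition T_sel ::
  "'a measure \<Rightarrow> nat \<Rightarrow> nat \<Rightarrow> (nat \<Rightarrow> nat \<Rightarrow> 'a \<Rightarrow> real) \<Rightarrow> (nat \<Rightarrow> 'a \<Rightarrow> real) \<Rightarrow>
   (dataset \<Rightarrow> nat set) \<Rightarrow> 'a \<Rightarrow> real" where
  "T_sel M n p X Y \<gamma> \<omega> = T_set M n p X Y (selected_set n p X Y \<gamma> \<omega>) \<omega>"

definition large_coeffs :: "nat \<Rightarrow> (nat \<Rightarrow> real) \<Rightarrow> real \<Rightarrow> nat set" where
  "large_coeffs p \<beta> b = {j \<in> {1..p}. (\<beta> j)\<^sup>2 > b}"

text \<open>
  Convergence in probability to a constant, where the \<open>n\<close>-th variable lives on its own probability
  space.
\<close>

definition tendsto_in_prob :: "(nat \<Rightarrow> 'a measure) \<Rightarrow> (nat \<Rightarrow> 'a \<Rightarrow> real) \<Rightarrow> real \<Rightarrow> bool" where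
  "tendsto_in_prob M Z c \<longleftrightarrow>
     (\<forall>\<^sub>F n in sequentially. Z n \<in> borel_measurable (M n)) \<and>
     (\<forall>e>0. (\<lambda>n. measure (M n) {\<omega> \<in> space (M n). \<bar>Z n \<omega> - c\<bar> > e}) \<longlonglongrightarrow> 0)"

end

theory Submission
  imports Defs
begin

text \<open>
  The two statistics are built by the same formula from the selected set and from the target set, so
  they agree wherever the algorithm selects the target set.  For every threshold \<open>e > 0\<close> the event
  that the scaled difference exceeds \<open>e\<close> is therefore contained in the event of a wrong selection,
  whatever the scaling factor is.  The probability of the latter tends to \<open>0\<close>, because already its
  square root multiplied by \<open>n\<close> does.

  The substance of the formal proof is measurability.  The event of a wrong selection has to be
  measurable for its probability to bound that of a subset.  The adaptive statistic \<open>T_sel\<close> is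
  measurable because the selected set is a random element of the finite set \<open>Pow {1..p}\<close>, and for
  each fixed value of it the statistic is a polynomial in the data.
\<close>

context linear_model
begin

lemma covariate_measurable:
  assumes "i \<in> {1..n}" and "j \<in> {1..p}"
  shows "X i j \<in> borel_measurable M"
  using covariate_integrable[OF assms] by (rule borel_measurable_integrable)

lemma covariate_vector_measurable:
  assumes "i \<in> {1..n}"
  shows "covariate_vector p X i \<in> measurable M (vec_space p)"
  unfolding covariate_vector_def[abs_def]
  by (intro measurable_restrict covariate_measurable assms)

text \<open>
  The regression equation is imposed on \<open>space M\<close> only, so the response may differ as a function
  from the linear predictor plus noise; measurability depends on the values on \<open>space M\<close> alone.
\<close>

lemma response_measurable:
  assumes "i \<in> {1..n}"
  shows "Y i \<in> borel_measurable M"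
proof -
  have "(\<lambda>\<omega>. (\<Sum>j\<in>{1..p}. \<beta> j * X i j \<omega>) + \<epsilon> i \<omega>) \<in> borel_measurable M"
    using covariate_measurable[OF assms] borel_measurable_integrable[OF noise_integrable[OF assms]]
    by (intro borel_measurable_add borel_measurable_sum borel_measurable_times) auto
  then show ?thesis
    using regression[OF assms] by (simp cong: measurable_cong)
qed

lemma W_measurable:
  assumes "i \<in> {1..n}" and "j \<in> {1..p}"
  shows "W X Y i j \<in> borel_measurable M"
  unfolding W_def[abs_def]
  by (intro borel_measurable_times covariate_measurable response_measurable assms)

lemma tau_sq_hat_measurable: "tau_sq_hat n p X Y \<in> borel_measurable M"
  unfolding tau_sq_hat_def[abs_def] split_beta
  by (intro borel_measurable_divide borel_measurable_sum borel_measurable_times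
        borel_measurable_const W_measurable) auto

lemma psi_hat_measurable:
  assumes "j \<in> {1..p}" and "j' \<in> {1..p}"
  shows "psi_hat M n X Y j j' \<in> borel_measurable M"
  unfolding psi_hat_def[abs_def] split_beta
  using assms
  by (intro borel_measurable_divide borel_measurable_sum borel_measurable_times
        borel_measurable_diff borel_measurable_const W_measurable covariate_measurable) auto

lemma T_set_measurable:
  assumes "B \<subseteq> {1..p}"
  shows "T_set M n p X Y B \<in> borel_measurable M"
  unfolding T_set_def[abs_def]
  using assms
  by (intro borel_measurable_diff borel_measurable_times borel_measurable_const
        borel_measurable_sum tau_sq_hat_measurable psi_hat_measurable) auto

lemma sample_measurable:
  "sample n p X Y \<in> measurable M (PiM {1..n} (\<lambda>_. vec_space p) \<Otimes>\<^sub>M vec_space n)"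
  unfolding sample_def[abs_def]
  by (intro measurable_Pair measurable_restrict covariate_vector_measurable response_measurable)

lemma selected_set_measurable:
  assumes "selection_algorithm n p \<gamma>"
  shows "selected_set n p X Y \<gamma> \<in> measurable M (count_space (Pow {1..p}))"
  using measurable_compose[OF sample_measurable assms[unfolded selection_algorithm_def]]
  unfolding selected_set_def[abs_def] .

text \<open>
  There are only finitely many possible selections, so gluing the measurable functions
  \<open>T_set M n p X Y S\<close> along the random index \<open>S\<close> preserves measurability.
\<close>

lemma T_sel_measurable:
  assumes "selection_algorithm n p \<gamma>"
  shows "T_sel M n p X Y \<gamma> \<in> borel_measurable M"
  unfolding T_sel_def[abs_def]
proof (rule measurable_compose_countable'[OF _ selected_set_measurable[OF assms]])
  show "countable (Pow {1..p})" by (simp add: countable_finite)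
qed (simp add: T_set_measurable)

lemma wrong_selection_event:
  assumes "selection_algorithm n p \<gamma>"
  shows "{\<omega> \<in> space M. selected_set n p X Y \<gamma> \<omega> \<noteq> B} \<in> events"
proof -
  have "selected_set n p X Y \<gamma> -` (Pow {1..p} - {B}) \<inter> space M \<in> events"
    using selected_set_measurable[OF assms] by (rule measurable_sets) simp
  also have "selected_set n p X Y \<gamma> -` (Pow {1..p} - {B}) \<inter> space M =
      {\<omega> \<in> space M. selected_set n p X Y \<gamma> \<omega> \<noteq> B}"
    using measurable_space[OF selected_set_measurable[OF assms]] by auto
  finally show ?thesis .
qed

text \<open>
  Where \<open>B\<close> is selected the difference vanishes exactly, which is why one bound serves every scaling
  factor \<open>c\<close>.
\<close>

lemma prob_scaled_difference_le_wrong_selection: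
  assumes "selection_algorithm n p \<gamma>" and "e \<ge> 0"
  shows "prob {\<omega> \<in> space M. \<bar>c * (T_sel M n p X Y \<gamma> \<omega> - T_set M n p X Y B \<omega>)\<bar> > e}
    \<le> prob {\<omega> \<in> space M. selected_set n p X Y \<gamma> \<omega> \<noteq> B}"
  using assms(2)
  by (intro finite_measure_mono wrong_selection_event assms(1)) (auto simp: T_sel_def)

end

lemma tendsto_zero_if_mult_sqrt_tendsto_zero:
  fixes q :: "nat \<Rightarrow> real"
  assumes nonneg: "\<And>n. q n \<ge> 0"
    and lim: "(\<lambda>n. real n * sqrt (q n)) \<longlonglongrightarrow> 0"
  shows "q \<longlonglongrightarrow> 0"
proof (rule tendsto_sandwich[where f = "\<lambda>_. 0"])
  show "(\<lambda>n. (real n * sqrt (q n))\<^sup>2) \<longlonglongrightarrow> 0"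
    using tendsto_power[OF lim, of 2] by simp
  have "q n \<le> (real n * sqrt (q n))\<^sup>2" if "n \<ge> 1" for n
  proof -
    have "1 * q n \<le> (real n)\<^sup>2 * q n"
      using that nonneg by (intro mult_right_mono one_le_power) auto
    then show ?thesis using nonneg by (simp add: power_mult_distrib)
  qed
  then show "\<forall>\<^sub>F n in sequentially. q n \<le> (real n * sqrt (q n))\<^sup>2"
    by (auto simp: eventually_sequentially)
qed (use nonneg in auto)

theorem proposition2p5:
  fixes M :: "nat \<Rightarrow> 'a measure"
    and p :: "nat \<Rightarrow> nat"
    and X :: "nat \<Rightarrow> nat \<Rightarrow> nat \<Rightarrow> 'a \<Rightarrow> real"
    and Y \<epsilon> :: "nat \<Rightarrow> nat \<Rightarrow> 'a \<Rightarrow> real"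
    and \<beta> :: "nat \<Rightarrow> nat \<Rightarrow> real"
    and \<sigma> :: "nat \<Rightarrow> real"
    and \<gamma> :: "nat \<Rightarrow> dataset \<Rightarrow> nat set"
    and B :: "nat \<Rightarrow> nat set"
    and b :: real
    and p\<^sub>0 :: nat
  assumes model: "\<And>n. n \<ge> 3 \<Longrightarrow> linear_model (M n) n (p n) (X n) (Y n) (\<epsilon> n) (\<beta> n) (\<sigma> n)"
    and algorithm: "\<And>n. n \<ge> 3 \<Longrightarrow> selection_algorithm n (p n) (\<gamma> n)"
    and b_pos: "b > 0"
    and B_eq: "\<And>n. n \<ge> 3 \<Longrightarrow> B n = large_coeffs (p n) (\<beta> n) b"
    and card_B: "\<And>n. n \<ge> 3 \<Longrightarrow> card (B n) = p\<^sub>0"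
    and consistent:
      "(\<lambda>n. real n * sqrt (measure (M n)
          {\<omega> \<in> space (M n). selected_set n (p n) (X n) (Y n) (\<gamma> n) \<omega> \<noteq> B n})) \<longlonglongrightarrow> 0"
    and T_sel_integrable:
      "\<And>n. n \<ge> 3 \<Longrightarrow> integrable (M n) (\<lambda>\<omega>. (T_sel (M n) n (p n) (X n) (Y n) (\<gamma> n) \<omega>) ^ 4)"
    and T_sel_bounded:
      "\<exists>C. \<forall>n\<ge>3. (\<integral>\<omega>. (T_sel (M n) n (p n) (X n) (Y n) (\<gamma> n) \<omega>) ^ 4 \<partial>(M n)) \<le> C"
    and T_B_integrable:
      "\<And>n. n \<ge> 3 \<Longrightarrow> integrable (M n) (\<lambda>\<omega>. (T_set (M n) n (p n) (X n) (Y n) (B n) \<omega>) ^ 4)"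
    and T_B_bounded:
      "\<exists>C. \<forall>n\<ge>3. (\<integral>\<omega>. (T_set (M n) n (p n) (X n) (Y n) (B n) \<omega>) ^ 4 \<partial>(M n)) \<le> C"
  shows "tendsto_in_prob M
    (\<lambda>n \<omega>. sqrt (real n) *
       (T_sel (M n) n (p n) (X n) (Y n) (\<gamma> n) \<omega> - T_set (M n) n (p n) (X n) (Y n) (B n) \<omega>)) 0"
  unfolding tendsto_in_prob_def
proof (intro conjI allI impI)
  show "\<forall>\<^sub>F n in sequentially. (\<lambda>\<omega>. sqrt (real n) *
      (T_sel (M n) n (p n) (X n) (Y n) (\<gamma> n) \<omega> - T_set (M n) n (p n) (X n) (Y n) (B n) \<omega>))
      \<in> borel_measurable (M n)"
    using eventually_ge_at_top[of 3]
  proof eventually_elim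
    case (elim n)
    interpret linear_model "M n" n "p n" "X n" "Y n" "\<epsilon> n" "\<beta> n" "\<sigma> n"
      using elim by (rule model)
    have "B n \<subseteq> {1..p n}"
      using B_eq[OF elim] by (auto simp: large_coeffs_def)
    then show ?case
      by (intro borel_measurable_times borel_measurable_diff borel_measurable_const
            T_sel_measurable T_set_measurable algorithm elim)
  qed
next
  fix e :: real
  assume "e > 0"
  let ?wrong = "\<lambda>n. measure (M n)
    {\<omega> \<in> space (M n). selected_set n (p n) (X n) (Y n) (\<gamma> n) \<omega> \<noteq> B n}"
  let ?far = "\<lambda>n. measure (M n) {\<omega> \<in> space (M n). \<bar>sqrt (real n) *
    (T_sel (M n) n (p n) (X n) (Y n) (\<gamma> n) \<omega> - T_set (M n) n (p n) (X n) (Y n) (B n) \<omega>) - 0\<bar> > e}"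
  show "?far \<longlonglongrightarrow> 0"
  proof (rule tendsto_sandwich[where f = "\<lambda>_. 0"])
    show "?wrong \<longlonglongrightarrow> 0"
      using consistent by (rule tendsto_zero_if_mult_sqrt_tendsto_zero[rotated]) simp
    show "\<forall>\<^sub>F n in sequentially. ?far n \<le> ?wrong n"
      using eventually_ge_at_top[of 3]
    proof eventually_elim
      case (elim n)
      interpret linear_model "M n" n "p n" "X n" "Y n" "\<epsilon> n" "\<beta> n" "\<sigma> n"
        using elim by (rule model)
      show ?case
        using prob_scaled_difference_le_wrong_selection[OF algorithm[OF elim]] \<open>e > 0\<close> by simp
    qed
  qed simp_all
qed

end
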